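(* Let $n\ge1$, $i\in[n]$, $N\in[2^n]$ and $p=2^i$. Then $$\{\mathcal{S}(c_{i,n},j,N): j\in[2^n]\}=\Big\{a\in\mathbb{Z} : \Big\lfloor\tfrac{N}{p}\Big\rfloor\tfrac{p}{2}+\max\big((N\bmod p)-\tfrac p2,0\big)\ \le a\ \le\ \Big\lfloor\tfrac{N}{p}\Big\rfloor\tfrac{p}{2}+\min\big(N\bmod p,\tfrac p2\big)\Big\}.$$
   Context: For $m\ge0$ and $i\ge1$, $\mathrm{bin}(m,i)$ is the $i$-th bit of $m$ counted from the least significant bit. For $i\in[n]$, $c_{i,n}$ is the $0$-$1$ list of length $2^n$ with $c_{i,n}(j)=\mathrm{bin}(j-1,i)$ (equivalently, $c_{i,n}$ is the block $0^{2^{i-1}}1^{2^{i-1}}$ repeated $2^{n-i}$ times). For a list $L$ of length $m$, $i\in[m]$ and $N\ge1$, the (cyclic) contiguous sum is $\mathcal{S}(L,i,N)=\sum_{j=0}^{N-1}L\big(1+((i+j-1)\bmod m)\big)$. *)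

theory Defs
  imports Main
begin

(* The library's "bit m k" counts positions from k = 0 at the least significant bit,
   whereas "bin m i" counts from i = 1; it is only meaningful for i >= 1. *)
definition bin :: "nat \<Rightarrow> nat \<Rightarrow> int" where
  "bin m i = of_bool (bit m (i - 1))"

definition clist :: "nat \<Rightarrow> nat \<Rightarrow> int list" where
  "clist i n = map (\<lambda>j. bin (j - 1) i) [1..<2 ^ n + 1]"

(* Mathematical positions start at 1, list indices at 0: the entry at position k is "L ! (k - 1)",
   so the entry at position 1 + ((i + j - 1) mod m) is "L ! ((i + j - 1) mod m)".
   The start position i is meant to be at least 1 (otherwise i + j - 1 truncates at j = 0). *)
definition cyc_sum :: "int list \<Rightarrow> nat \<Rightarrow> nat \<Rightarrow> int" where
  "cyc_sum L i N = (\<Sum>j<N. L ! ((i + j - 1) mod length L))"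

end

theory Submission
  imports Defs
begin

text \<open>
  With \<open>h = 2 ^ (i - 1)\<close>, the infinite periodic sequence of which \<open>clist i n\<close> is a prefix has
  the closed partial sums \<open>F x = h * (x div 2h) + max (x mod 2h - h) 0\<close>, and a contiguous sum is
  a difference \<open>F (s + N) - F s\<close>. The bounds follow by splitting according to whether
  \<open>s mod 2h + N mod 2h\<close> wraps around \<open>2h\<close>. To attain \<open>q * h + a\<close>, where \<open>N = q * 2h + r\<close>, start
  at \<open>s = h + a - r\<close>: then \<open>s \<le> h\<close>, so the sum starts within zeros, and it ends after exactly
  \<open>a\<close> ones of the \<open>q\<close>-th block.
\<close>

text \<open>This is \<open>F\<close>; truncated subtraction on \<open>nat\<close> supplies the
  maximum with 0.\<close>

definition block_sum :: "nat \<Rightarrow> nat \<Rightarrow> nat" where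
  "block_sum h x = h * (x div (2 * h)) + (x mod (2 * h) - h)"

text \<open>Modulo \<open>2 * 2 ^ k\<close> there remain bit \<open>k\<close>, weighted by
  \<open>2 ^ k\<close>, and lower bits worth less than \<open>2 ^ k\<close> in total.\<close>

lemma bit_nat_iff_le_mod: "bit (x :: nat) k \<longleftrightarrow> 2 ^ k \<le> x mod (2 * 2 ^ k)"
proof -
  have "x mod (2 ^ k * 2) = 2 ^ k * (x div 2 ^ k mod 2) + x mod 2 ^ k"
    by (rule mod_mult2_eq)
  moreover have "\<not> 2 ^ k \<le> x mod 2 ^ k" by (simp add: not_le)
  ultimately show ?thesis
    by (cases "odd (x div 2 ^ k)") (auto simp: bit_iff_odd odd_iff_mod_2_eq_one mult.commute)
qed

text \<open>When the remainder \<open>2 * h - 1\<close> wraps to 0, the second summand loses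
  \<open>h - 1\<close> and the first gains \<open>h\<close>, again a step of 1.\<close>

lemma block_sum_Suc:
  assumes "h > 0"
  shows "block_sum h (Suc x) = block_sum h x + of_bool (h \<le> x mod (2 * h))"
proof -
  have "x mod (2 * h) < 2 * h" using assms by simp
  then show ?thesis
    using assms by (auto simp: block_sum_def div_Suc mod_Suc)
qed

lemma block_sum_add_mult:
  assumes "h > 0"
  shows "block_sum h (k * (2 * h) + x) = k * h + block_sum h x"
  unfolding block_sum_def using assms
  by (simp only: div_mult_self3 mod_mult_self3) (simp add: algebra_simps)

lemma block_sum_less: "x < 2 * h \<Longrightarrow> block_sum h x = x - h"
  by (simp add: block_sum_def)

lemma sum_block:
  assumes "h > 0"
  shows "(\<Sum>k<N. of_bool (h \<le> (s + k) mod (2 * h)) :: int) =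
    int (block_sum h (s + N)) - int (block_sum h s)"
  by (induction N) (auto simp: block_sum_Suc[OF assms])

text \<open>Reduction modulo \<open>2 ^ n\<close> keeps bit \<open>i - 1\<close>, as
  \<open>i - 1 < n\<close>; so cyclic reading of the list agrees with the infinite periodic
  sequence. The offset \<open>s\<close> counts from 0.\<close>

lemma cyc_sum_clist:
  assumes "i \<in> {1..n}"
  shows "cyc_sum (clist i n) (Suc s) N =
    int (block_sum (2 ^ (i - 1)) (s + N)) - int (block_sum (2 ^ (i - 1)) s)"
proof -
  have "clist i n ! ((Suc s + k - 1) mod length (clist i n)) =
      of_bool (2 ^ (i - 1) \<le> (s + k) mod (2 * 2 ^ (i - 1)))" for k
  proof -
    have "(s + k) mod 2 ^ n < 2 ^ n" by simp
    then have "clist i n ! ((Suc s + k - 1) mod length (clist i n)) =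
        of_bool (bit (take_bit n (s + k)) (i - 1))"
      by (simp add: clist_def bin_def take_bit_eq_mod del: upt_Suc)
    also have "bit (take_bit n (s + k)) (i - 1) = bit (s + k) (i - 1)"
      using assms by (auto simp: bit_take_bit_iff)
    finally show ?thesis
      by (simp only: bit_nat_iff_le_mod)
  qed
  then show ?thesis
    unfolding cyc_sum_def by (simp only: sum_block zero_less_power zero_less_numeral)
qed

text \<open>Complete periods in \<open>s\<close> cancel and those in \<open>N\<close> give
  \<open>q * h\<close>, which leaves a piecewise linear function of the two remainders.\<close>

lemma block_sum_diff_bounds:
  fixes h N s :: nat
  assumes "h > 0"
  defines "q \<equiv> N div (2 * h)" and "r \<equiv> N mod (2 * h)"
  defines "d \<equiv> int (block_sum h (s + N)) - int (block_sum h s)"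
  shows "int (q * h) + max (int r - int h) 0 \<le> d" and "d \<le> int (q * h) + min (int r) (int h)"
proof -
  define u v where "u = s div (2 * h)" and "v = s mod (2 * h)"
  have s: "s = u * (2 * h) + v" and N: "N = q * (2 * h) + r"
    by (simp_all only: u_def v_def q_def r_def div_mult_mod_eq)
  have v: "v < 2 * h" and r: "r < 2 * h"
    using assms(1) by (simp_all add: v_def r_def)
  have "s + N = (u + q) * (2 * h) + (v + r)"
    unfolding s N by (simp add: algebra_simps)
  then have "block_sum h (s + N) = (u + q) * h + block_sum h (v + r)"
    by (simp only: block_sum_add_mult[OF assms(1)])
  moreover have "block_sum h s = u * h + (v - h)"
    unfolding s by (simp only: block_sum_add_mult[OF assms(1)] block_sum_less[OF v])
  ultimately have d: "d = int (q * h) + int (block_sum h (v + r)) - int (v - h)"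
    by (simp add: d_def algebra_simps)
  \<comment> \<open>Since \<open>v + r < 4 * h\<close>, at most one more period is
    completed.\<close>
  have "block_sum h (v + r) = (if v + r < 2 * h then v + r - h else h + (v + r - 2 * h - h))"
  proof (cases "v + r < 2 * h")
    case False
    then have "v + r = 1 * (2 * h) + (v + r - 2 * h)" by simp
    then have "block_sum h (v + r) = 1 * h + block_sum h (v + r - 2 * h)"
      by (metis block_sum_add_mult[OF assms(1)])
    with False v r show ?thesis by (simp add: block_sum_less)
  qed (simp add: block_sum_less)
  with v r show "int (q * h) + max (int r - int h) 0 \<le> d"
    and "d \<le> int (q * h) + min (int r) (int h)"
    unfolding d by (auto split: if_splits simp: max_def min_def of_nat_diff)
qed

text \<open>The three bounds on \<open>a\<close> are the integer condition
  \<open>max (r - h) 0 \<le> a \<le> min r h\<close> without subtraction.\<close>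

lemma block_sum_diff_attained:
  fixes h N a :: nat
  assumes "h > 0"
  defines "r \<equiv> N mod (2 * h)"
  assumes "r \<le> a + h" and "a \<le> r" and "a \<le> h"
  shows "block_sum h (a + h - r + N) = N div (2 * h) * h + a" and "block_sum h (a + h - r) = 0"
proof -
  have N: "N = N div (2 * h) * (2 * h) + r"
    by (simp only: r_def div_mult_mod_eq)
  have "a + h - r + N = N div (2 * h) * (2 * h) + (a + h)"
    using N assms(3) by linarith
  moreover have "block_sum h (a + h) = a"
  proof (cases "a = h")
    \<comment> \<open>Here \<open>a + h\<close> is a full period, just beyond the reach of
      \<open>block_sum_less\<close>.\<close>
    case True
    then show ?thesis using assms(1) by (simp add: block_sum_def flip: mult_2)
  qed (use assms(5) in \<open>simp add: block_sum_less\<close>)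
  ultimately show "block_sum h (a + h - r + N) = N div (2 * h) * h + a"
    by (simp only: block_sum_add_mult[OF assms(1)])
  show "block_sum h (a + h - r) = 0"
    using assms by (subst block_sum_less) auto
qed

theorem theorem14:
  fixes n i N :: nat and p :: int
  assumes "n \<ge> 1"
    and "i \<in> {1..n}"
    and "N \<in> {1..2 ^ n}"
    and "p = 2 ^ i"
  shows "{cyc_sum (clist i n) j N | j. j \<in> {1..2 ^ n}} =
    {a :: int.
      (int N div p) * (p div 2) + max ((int N mod p) - p div 2) 0 \<le> a \<and>
      a \<le> (int N div p) * (p div 2) + min (int N mod p) (p div 2)}"
proof -
  define h :: nat where "h = 2 ^ (i - 1)"
  define q r where "q = N div (2 * h)" and "r = N mod (2 * h)"
  have h: "h > 0" by (simp add: h_def)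
  have "2 * h = 2 ^ i"
    using assms(2) by (cases i) (auto simp: h_def)
  then have p: "p = int (2 * h)" using assms(4) by simp
  have half: "p div 2 = int h" by (simp add: p)
  have q: "int N div p = int q" and r: "int N mod p = int r"
    by (simp_all only: p q_def r_def of_nat_div of_nat_mod)
  \<comment> \<open>The witness has offset at most \<open>h\<close>, so this keeps its position
    within \<open>2 ^ n\<close>.\<close>
  have "h < 2 ^ n"
    using assms(2) unfolding h_def by (intro power_strict_increasing) auto
  note cyc = cyc_sum_clist[OF assms(2), folded h_def]
  show ?thesis
    unfolding half q r
  proof (intro equalityI subsetI)
    fix x assume "x \<in> {cyc_sum (clist i n) j N | j. j \<in> {1..2 ^ n}}"
    then obtain j where "x = cyc_sum (clist i n) j N" and "j \<ge> 1" by auto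
    then have "x = cyc_sum (clist i n) (Suc (j - 1)) N" by simp
    then show "x \<in> {a. int q * int h + max (int r - int h) 0 \<le> a \<and>
        a \<le> int q * int h + min (int r) (int h)}"
      using block_sum_diff_bounds[OF h, where N = N and s = "j - 1"] by (simp add: cyc q_def r_def)
  next
    fix x assume x: "x \<in> {a. int q * int h + max (int r - int h) 0 \<le> a \<and>
        a \<le> int q * int h + min (int r) (int h)}"
    \<comment> \<open>The lower bound on \<open>x\<close> is at least \<open>q * h\<close>, so
      \<open>nat\<close> does not truncate.\<close>
    define a where "a = nat (x - int q * int h)"
    have xa: "x = int q * int h + int a"
      and a: "r \<le> a + h" "a \<le> r" "a \<le> h"
      using x by (auto simp: a_def)
    have "x = cyc_sum (clist i n) (Suc (a + h - r)) N"
      using block_sum_diff_attained[OF h, where N = N and a = a] a by (simp add: cyc xa q_def r_def)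
    moreover have "Suc (a + h - r) \<in> {1..2 ^ n}"
      using a \<open>h < 2 ^ n\<close> by auto
    ultimately show "x \<in> {cyc_sum (clist i n) j N | j. j \<in> {1..2 ^ n}}"
      by blast
  qed
qed

end
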